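(* Let $q_0,q_1:\mathbb{R}^n\to\mathbb{R}$ be quadratic functions $q_i(x)=x^\top A_i x+2b_i^\top x+c_i$ with $A_i\in\mathbb{R}^{n\times n}$ symmetric, $b_i\in\mathbb{R}^n$, $c_i\in\mathbb{R}$, and suppose there exists $\gamma^*\geq 0$ with $A_0+\gamma^*A_1\succ 0$. Consider the closed nonempty interval $\Gamma:=\{\gamma\geq 0: A_0+\gamma A_1\succeq 0\}$ and let $\gamma_-$ be its leftmost endpoint. (1) If $\Gamma$ is bounded above, let $\gamma_+$ be its rightmost endpoint. Then $\operatorname{conv}(\mathcal{S})=\mathcal{S}(\gamma_-)\cap\mathcal{S}(\gamma_+)$, and $\min_{x\in\mathbb{R}^n}\{q_0(x): q_1(x)\leq 0\}=\min_{x\in\mathbb{R}^n}\max\{q(\gamma_-,x),q(\gamma_+,x)\}$. (2) If $\Gamma$ is not bounded above, then $q_1$ is convex, $\operatorname{conv}(\mathcal{S})=\mathcal{S}(\gamma_-)\cap\{(x,t)\in\mathbb{R}^{n+1}: q_1(x)\leq 0\}$, and $\min_{x\in\mathbb{R}^n}\{q_0(x): q_1(x)\leq 0\}=\min_{x\in\mathbb{R}^n}\{q(\gamma_-,x): q_1(x)\leq 0\}$.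
   Context: For $\gamma\in\mathbb{R}$, $q(\gamma,x):=q_0(x)+\gamma q_1(x)$. $\mathcal{S}:=\{(x,t)\in\mathbb{R}^{n+1}: q_0(x)\leq t,\ q_1(x)\leq 0\}$ and for $\gamma\geq 0$, $\mathcal{S}(\gamma):=\{(x,t)\in\mathbb{R}^{n+1}: q(\gamma,x)\leq t\}$. $\operatorname{conv}$ denotes convex hull. *)

theory Defs
  imports "HOL-Analysis.Analysis"
begin

definition pos_def :: "real^'n^'n \<Rightarrow> bool" where
  "pos_def A \<longleftrightarrow> transpose A = A \<and> (\<forall>x. x \<noteq> 0 \<longrightarrow> 0 < x \<bullet> (A *v x))"

definition pos_semidef :: "real^'n^'n \<Rightarrow> bool" where
  "pos_semidef A \<longleftrightarrow> transpose A = A \<and> (\<forall>x. 0 \<le> x \<bullet> (A *v x))"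

definition quad :: "real^'n^'n \<Rightarrow> real^'n \<Rightarrow> real \<Rightarrow> real^'n \<Rightarrow> real" where
  "quad A b c x = x \<bullet> (A *v x) + 2 * (b \<bullet> x) + c"

definition q_comb :: "('a \<Rightarrow> real) \<Rightarrow> ('a \<Rightarrow> real) \<Rightarrow> real \<Rightarrow> 'a \<Rightarrow> real" where
  "q_comb q0 q1 \<gamma> x = q0 x + \<gamma> * q1 x"

definition S_epi :: "('a \<Rightarrow> real) \<Rightarrow> ('a \<Rightarrow> real) \<Rightarrow> ('a \<times> real) set" where
  "S_epi q0 q1 = {(x, t). q0 x \<le> t \<and> q1 x \<le> 0}"

definition S_gamma :: "('a \<Rightarrow> real) \<Rightarrow> ('a \<Rightarrow> real) \<Rightarrow> real \<Rightarrow> ('a \<times> real) set" where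
  "S_gamma q0 q1 \<gamma> = {(x, t). q_comb q0 q1 \<gamma> x \<le> t}"

definition Gamma_set :: "real^'n^'n \<Rightarrow> real^'n^'n \<Rightarrow> real set" where
  "Gamma_set A0 A1 = {\<gamma>. 0 \<le> \<gamma> \<and> pos_semidef (A0 + \<gamma> *\<^sub>R A1)}"

definition gamma_minus :: "real^'n^'n \<Rightarrow> real^'n^'n \<Rightarrow> real" where
  "gamma_minus A0 A1 = Inf (Gamma_set A0 A1)"

text \<open>Only meaningful when the interval is bounded above.\<close>

definition gamma_plus :: "real^'n^'n \<Rightarrow> real^'n^'n \<Rightarrow> real" where
  "gamma_plus A0 A1 = Sup (Gamma_set A0 A1)"

text \<open>The value \<open>m\<close> is the minimum of \<open>f\<close> over \<open>X\<close>: it is attained if \<open>X\<close> is nonempty, and an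
  infeasible problem has value \<open>\<infinity>\<close>.\<close>

definition is_min :: "('a \<Rightarrow> real) \<Rightarrow> 'a set \<Rightarrow> ereal \<Rightarrow> bool" where
  "is_min f X m \<longleftrightarrow>
     (X = {} \<and> m = \<infinity>) \<or> (\<exists>x\<in>X. m = ereal (f x) \<and> (\<forall>y\<in>X. f x \<le> f y))"

end

theory Submission imports Defs begin

text \<open>At an endpoint \<open>\<gamma> > 0\<close> of the interval \<open>\<Gamma>\<close> the matrix \<open>A\<^sub>0 + \<gamma> A\<^sub>1\<close> has a kernel vector \<open>u\<close>.
  Along the line \<open>x + s u\<close> the function \<open>q(\<gamma>, \<cdot>)\<close> is affine, while \<open>q\<^sub>1\<close> is a genuine quadratic,
  strictly convex at the left endpoint and strictly concave at the right one. If \<open>q(\<gamma>, x) \<le> t\<close> and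
  \<open>q\<^sub>1 x\<close> has the opposite sign to the curvature, then \<open>q\<^sub>1\<close> vanishes at two points of the line on
  either side of \<open>x\<close>; there \<open>q\<^sub>0 = q(\<gamma>, \<cdot>)\<close>, so lifting the line with the slope of \<open>q(\<gamma>, \<cdot>)\<close>
  exhibits \<open>(x, t)\<close> as a convex combination of two points of \<open>\<S>\<close>. The equality of minima follows
  since \<open>{(x, t). m \<le> t}\<close> is convex.\<close>

section \<open>Quadratic functions along lines and in the pencil\<close>

lemma symmetric_matrix_inner_commute:
  fixes A :: "real^'n^'n"
  assumes "transpose A = A"
  shows "x \<bullet> (A *v y) = y \<bullet> (A *v x)"
  by (metis assms dot_lmul_matrix inner_commute transpose_matrix_vector)

text \<open>Restriction to a line is a polynomial in \<open>s\<close> whose leading coefficient is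
  the curvature along \<open>u\<close>; symmetry merges the two cross terms.\<close>

lemma quad_add_scaleR:
  fixes A :: "real^'n^'n"
  assumes "transpose A = A"
  shows "quad A b c (x + s *\<^sub>R u)
    = (u \<bullet> (A *v u)) * s\<^sup>2 + 2 * (u \<bullet> (A *v x) + b \<bullet> u) * s + quad A b c x"
  using symmetric_matrix_inner_commute[OF assms, of x u]
  by (simp add: quad_def matrix_vector_right_distrib matrix_vector_mult_scaleR inner_add_left
      inner_add_right power2_eq_square algebra_simps)

lemma inner_pencil:
  fixes A0 A1 :: "real^'n^'n"
  shows "x \<bullet> ((A0 + \<gamma> *\<^sub>R A1) *v y) = x \<bullet> (A0 *v y) + \<gamma> * (x \<bullet> (A1 *v y))"
  by (simp add: matrix_vector_mult_add_rdistrib scaleR_matrix_vector_assoc[symmetric]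
      inner_add_right)

lemma transpose_pencil:
  fixes A0 A1 :: "real^'n^'n"
  assumes "transpose A0 = A0" "transpose A1 = A1"
  shows "transpose (A0 + \<gamma> *\<^sub>R A1) = A0 + \<gamma> *\<^sub>R A1"
  using assms by (simp add: transpose_def vec_eq_iff)

lemma q_comb_quad:
  "q_comb (quad A0 b0 c0) (quad A1 b1 c1) \<gamma>
    = quad (A0 + \<gamma> *\<^sub>R A1) (b0 + \<gamma> *\<^sub>R b1) (c0 + \<gamma> * c1)"
  by (rule ext, unfold q_comb_def quad_def inner_pencil) (simp add: inner_add_left algebra_simps)

text \<open>On the segment from \<open>x\<close> to \<open>y\<close> only the square term is
  nonlinear. Its coefficient is nonnegative, so \<open>s\<^sup>2 \<le> s\<close> on the unit
  interval suffices.\<close>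

lemma convex_on_quad:
  fixes A :: "real^'n^'n"
  assumes "pos_semidef A"
  shows "convex_on UNIV (quad A b c)"
proof (rule convex_onI)
  fix s :: real and x y :: "real^'n"
  assume s: "0 < s" "s < 1"
  have sym: "transpose A = A" and psd: "0 \<le> z \<bullet> (A *v z)" for z
    using assms by (auto simp: pos_semidef_def)
  define u where "u = y - x"
  have "quad A b c y = quad A b c (x + 1 *\<^sub>R u)" by (simp add: u_def)
  then have y: "quad A b c y
      = (u \<bullet> (A *v u)) + 2 * (u \<bullet> (A *v x) + b \<bullet> u) + quad A b c x"
    unfolding quad_add_scaleR[OF sym] by simp
  have "(1 - s) *\<^sub>R x + s *\<^sub>R y = x + s *\<^sub>R u"
    by (simp add: u_def algebra_simps)
  moreover have "(u \<bullet> (A *v u)) * s\<^sup>2 \<le> (u \<bullet> (A *v u)) * s"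
    using psd[of u] s by (intro mult_left_mono) (auto simp: power2_eq_square mult_left_le)
  ultimately show "quad A b c ((1 - s) *\<^sub>R x + s *\<^sub>R y)
      \<le> (1 - s) * quad A b c x + s * quad A b c y"
    unfolding y by (simp add: quad_add_scaleR[OF sym] algebra_simps)
qed simp

lemma convex_lower_level_set:
  assumes "convex_on S f"
  shows "convex {x \<in> S. f x \<le> r}"
proof (rule convexI)
  fix x y u v
  assume xy: "x \<in> {x \<in> S. f x \<le> r}" "y \<in> {x \<in> S. f x \<le> r}"
    and uv: "0 \<le> u" "0 \<le> v" "u + v = (1 :: real)"
  have "f (u *\<^sub>R x + v *\<^sub>R y) \<le> max (f x) (f y)"
    using convex_lower[OF assms] xy uv by simp
  moreover have "u *\<^sub>R x + v *\<^sub>R y \<in> S"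
    using convexD[OF convex_on_imp_convex[OF assms]] xy uv by simp
  ultimately show "u *\<^sub>R x + v *\<^sub>R y \<in> {x \<in> S. f x \<le> r}"
    using xy by auto
qed

lemma continuous_on_quad: "continuous_on X (quad A b c)"
  unfolding quad_def
  by (intro continuous_intros linear_continuous_on_compose matrix_vector_mul_linear)

section \<open>Semidefinite and definite forms\<close>

lemma pos_def_imp_pos_semidef: "pos_def A \<Longrightarrow> pos_semidef A"
  unfolding pos_def_def pos_semidef_def
  by (metis inner_zero_left order_less_imp_le order_refl)

text \<open>If \<open>w = A *v x\<close> were nonzero, a small step from \<open>x\<close> along
  \<open>- w\<close> would make the form negative: the first-order decrease outweighs the
  second-order term.\<close>

lemma pos_semidef_kernel:
  fixes A :: "real^'n^'n"
  assumes "pos_semidef A" "x \<bullet> (A *v x) = 0"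
  shows "A *v x = 0"
proof -
  have sym: "transpose A = A" and psd: "0 \<le> z \<bullet> (A *v z)" for z
    using assms by (auto simp: pos_semidef_def)
  define w where "w = A *v x"
  define k where "k = w \<bullet> (A *v w)"
  have k: "k \<ge> 0" using psd by (simp add: k_def)
  show ?thesis
  proof (rule ccontr)
    assume "A *v x \<noteq> 0"
    then have pos: "0 < w \<bullet> w" by (simp add: w_def)
    \<comment> \<open>The denominator \<open>k + 1\<close> is positive even when
      \<open>k = 0\<close>, and it keeps \<open>- (k * r)\<close> below
      \<open>w \<bullet> w\<close>, so at least half of \<open>2 * (w \<bullet> w)\<close>
      survives.\<close>
    define r where "r = - (w \<bullet> w) / (k + 1)"
    have "0 \<le> quad A 0 0 (x + r *\<^sub>R w)"
      using psd by (simp add: quad_def)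
    then have "0 \<le> r * (k * r + 2 * (w \<bullet> w))"
      unfolding quad_add_scaleR[OF sym] using assms(2)
      by (simp add: quad_def k_def w_def power2_eq_square algebra_simps)
    moreover have "r < 0" using k pos by (simp add: r_def field_simps)
    moreover have "- (k * r) \<le> w \<bullet> w" using k pos by (simp add: r_def field_simps)
    ultimately show False using pos by (simp add: zero_le_mult_iff)
  qed
qed

text \<open>The constant is the minimum of the form on the unit sphere, attained by compactness;
  homogeneity of degree two carries the bound to all vectors.\<close>

lemma pos_def_coercive:
  fixes A :: "real^'n^'n"
  assumes "pos_def A"
  obtains k where "k > 0" "\<And>x. k * (norm x)\<^sup>2 \<le> x \<bullet> (A *v x)"
proof -
  let ?S = "sphere (0 :: real^'n) 1"
  have "continuous_on ?S (\<lambda>x. x \<bullet> (A *v x))"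
    by (intro continuous_intros linear_continuous_on_compose matrix_vector_mul_linear)
  then obtain e where e: "e \<in> ?S" "\<And>x. x \<in> ?S \<Longrightarrow> e \<bullet> (A *v e) \<le> x \<bullet> (A *v x)"
    using continuous_attains_inf[of ?S "\<lambda>x. x \<bullet> (A *v x)"] by auto
  show thesis
  proof
    show "0 < e \<bullet> (A *v e)" using assms e(1) by (metis pos_def_def mem_sphere_0 norm_zero zero_neq_one)
    fix x :: "real^'n"
    show "(e \<bullet> (A *v e)) * (norm x)\<^sup>2 \<le> x \<bullet> (A *v x)"
    proof (cases "x = 0")
      case False
      define y where "y = x /\<^sub>R norm x"
      have x: "x = norm x *\<^sub>R y" using False by (simp add: y_def)
      have "y \<in> ?S" using False by (simp add: y_def)
      then have "(e \<bullet> (A *v e)) * (norm x)\<^sup>2 \<le> (y \<bullet> (A *v y)) * (norm x)\<^sup>2"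
        using e(2) by (intro mult_right_mono) auto
      also have "\<dots> = (norm x *\<^sub>R y) \<bullet> (A *v (norm x *\<^sub>R y))"
        by (simp add: matrix_vector_mult_scaleR power2_eq_square)
      finally show ?thesis using x by simp
    qed simp
  qed
qed

lemma inner_matrix_bound:
  fixes A :: "real^'n^'n"
  obtains K where "K > 0" "\<And>x. \<bar>x \<bullet> (A *v x)\<bar> \<le> K * (norm x)\<^sup>2"
proof -
  obtain K where K: "K > 0" "\<And>x. norm (A *v x) \<le> norm x * K"
    using bounded_linear.pos_bounded[OF matrix_vector_mul_bounded_linear[of A]] by blast
  have "\<bar>x \<bullet> (A *v x)\<bar> \<le> K * (norm x)\<^sup>2" for x
  proof -
    have "\<bar>x \<bullet> (A *v x)\<bar> \<le> norm x * norm (A *v x)" by (rule Cauchy_Schwarz_ineq2)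
    also have "\<dots> \<le> norm x * (norm x * K)" using K(2) by (intro mult_left_mono) auto
    finally show ?thesis by (simp add: power2_eq_square mult_ac)
  qed
  with K(1) show thesis by (rule that)
qed

text \<open>The coercivity constant \<open>k\<close> of \<open>A\<close> absorbs the perturbation,
  which is at most \<open>\<bar>s\<bar> * K * (norm x)\<^sup>2\<close>, as long as
  \<open>\<bar>s\<bar> \<le> k / K\<close>.\<close>

lemma pos_def_perturb:
  fixes A B :: "real^'n^'n"
  assumes "pos_def A" "transpose B = B"
  obtains e where "e > 0" "\<And>s. \<bar>s\<bar> \<le> e \<Longrightarrow> pos_semidef (A + s *\<^sub>R B)"
proof -
  obtain k where k: "k > 0" "\<And>x. k * (norm x)\<^sup>2 \<le> x \<bullet> (A *v x)"
    using pos_def_coercive[OF assms(1)] by blast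
  obtain K where K: "K > 0" "\<And>x. \<bar>x \<bullet> (B *v x)\<bar> \<le> K * (norm x)\<^sup>2"
    using inner_matrix_bound by blast
  show thesis
  proof
    show "k / K > 0" using k K by simp
    fix s assume s: "\<bar>s\<bar> \<le> k / K"
    have "0 \<le> x \<bullet> ((A + s *\<^sub>R B) *v x)" for x
    proof -
      have "\<bar>s * (x \<bullet> (B *v x))\<bar> \<le> k / K * (K * (norm x)\<^sup>2)"
        unfolding abs_mult using s K by (intro mult_mono) auto
      then show ?thesis using k(2)[of x] K(1) by (simp add: inner_pencil)
    qed
    then show "pos_semidef (A + s *\<^sub>R B)"
      using assms transpose_pencil[of A B s] by (auto simp: pos_semidef_def pos_def_def)
  qed
qed

text \<open>Coercivity gives quadratic growth, which beats the linear term outside a large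
  ball.\<close>

lemma bounded_quad_sublevel:
  fixes A :: "real^'n^'n"
  assumes "pos_def A"
  shows "bounded {x. quad A b c x \<le> r}"
proof -
  obtain k where k: "k > 0" "\<And>x. k * (norm x)\<^sup>2 \<le> x \<bullet> (A *v x)"
    using pos_def_coercive[OF assms] by blast
  \<comment> \<open>The summand 1 forces \<open>norm x > 1\<close> outside the ball, so that
    multiplying by \<open>norm x\<close> does not shrink \<open>\<bar>r - c\<bar>\<close>; the
    quotient makes \<open>k * norm x\<close> exceed
    \<open>2 * norm b + \<bar>r - c\<bar>\<close>.\<close>
  define R where "R = (2 * norm b + \<bar>r - c\<bar>) / k + 1"
  have "norm x \<le> R" if "quad A b c x \<le> r" for x
  proof (rule ccontr)
    assume "\<not> norm x \<le> R"
    then have n: "(2 * norm b + \<bar>r - c\<bar>) / k + 1 < norm x" by (simp add: R_def)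
    moreover have "0 \<le> (2 * norm b + \<bar>r - c\<bar>) / k" using k by simp
    ultimately have n1: "1 < norm x" by linarith
    have "(2 * norm b + \<bar>r - c\<bar>) / k < norm x" using n by simp
    then have "2 * norm b + \<bar>r - c\<bar> < k * norm x" using k(1) by (simp add: field_simps)
    then have "norm x * \<bar>r - c\<bar> < norm x * (k * norm x - 2 * norm b)"
      using n1 by (intro mult_strict_left_mono) auto
    moreover have "1 * \<bar>r - c\<bar> \<le> norm x * \<bar>r - c\<bar>"
      using n1 by (intro mult_right_mono) auto
    moreover have "- (norm b * norm x) \<le> b \<bullet> x"
      using Cauchy_Schwarz_ineq2[of b x] by linarith
    ultimately show False
      using that k(2)[of x] by (simp add: quad_def power2_eq_square algebra_simps)
  qed
  then show ?thesis by (auto simp: bounded_iff)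
qed

section \<open>Lifted lines and the convex hull\<close>

text \<open>Since \<open>a\<close> and \<open>c\<close> have opposite signs or \<open>c = 0\<close>,
  the discriminant is at least \<open>b\<^sup>2\<close>, so its root dominates
  \<open>\<bar>b\<bar>\<close> and the two solutions of the quadratic formula lie on either side of
  0.\<close>

lemma quadratic_roots_around_zero:
  fixes a b c :: real
  assumes "a > 0" "c \<le> 0"
  obtains s1 s2 where "s1 \<le> 0" "0 \<le> s2" "a * s1\<^sup>2 + b * s1 + c = 0" "a * s2\<^sup>2 + b * s2 + c = 0"
proof -
  define D where "D = b\<^sup>2 - 4 * a * c"
  have D: "b\<^sup>2 \<le> D" using assms by (simp add: D_def mult_nonneg_nonpos)
  then have "0 \<le> D" by (rule order_trans[OF zero_le_power2])
  then have sq: "(sqrt D)\<^sup>2 = D" by simp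
  have "\<bar>b\<bar> \<le> sqrt D" using D real_le_rsqrt[of "\<bar>b\<bar>" D] by simp
  then have ineq: "- b - sqrt D \<le> 0" "0 \<le> - b + sqrt D" by linarith+
  have root: "a * s\<^sup>2 + b * s + c = 0" if "2 * a * s + b = d" "d\<^sup>2 = D" for s d
  proof -
    have "4 * a * (a * s\<^sup>2 + b * s + c) = (2 * a * s + b)\<^sup>2 - D"
      by (simp add: D_def power2_eq_square algebra_simps)
    then show ?thesis using that assms(1) by simp
  qed
  show thesis
  proof
    show "(- b - sqrt D) / (2 * a) \<le> 0" "0 \<le> (- b + sqrt D) / (2 * a)"
      using ineq assms(1) by (auto simp: divide_le_0_iff zero_le_divide_iff)
    show "a * ((- b - sqrt D) / (2 * a))\<^sup>2 + b * ((- b - sqrt D) / (2 * a)) + c = 0"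
      using assms(1) sq by (intro root[of _ "- sqrt D"]) auto
    show "a * ((- b + sqrt D) / (2 * a))\<^sup>2 + b * ((- b + sqrt D) / (2 * a)) + c = 0"
      using assms(1) sq by (intro root[of _ "sqrt D"]) auto
  qed
qed

lemma mem_convex_hull_between:
  fixes x u :: "'a::real_vector"
  assumes "s1 \<le> 0" "0 \<le> s2" "x + s1 *\<^sub>R u \<in> S" "x + s2 *\<^sub>R u \<in> S"
  shows "x \<in> convex hull S"
proof (cases "s1 = s2")
  case True
  then show ?thesis using assms by (simp add: hull_inc)
next
  case False
  then have d: "s2 - s1 > 0" using assms by simp
  \<comment> \<open>The weights solve \<open>v + w = 1\<close> and
    \<open>v * s1 + w * s2 = 0\<close>, so the displacements along \<open>u\<close> cancel.\<close>
  define v w where "v = s2 / (s2 - s1)" and "w = - s1 / (s2 - s1)"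
  have sum: "v + w = 1" and zero: "v * s1 + w * s2 = 0"
    using d by (auto simp: v_def w_def diff_divide_distrib[symmetric])
  have "v *\<^sub>R (x + s1 *\<^sub>R u) + w *\<^sub>R (x + s2 *\<^sub>R u) \<in> convex hull S"
    using assms d sum
    by (intro convexD[OF convex_convex_hull] hull_inc) (auto simp: v_def w_def divide_nonpos_pos)
  also have "v *\<^sub>R (x + s1 *\<^sub>R u) + w *\<^sub>R (x + s2 *\<^sub>R u) = (v + w) *\<^sub>R x + (v * s1 + w * s2) *\<^sub>R u"
    by (simp add: algebra_simps)
  finally show ?thesis by (simp add: sum zero)
qed

text \<open>The sign condition on the product treats both endpoints at once: positive curvature with
  \<open>q1 x \<le> 0\<close>, or negative curvature with \<open>q1 x \<ge> 0\<close>.\<close>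

lemma S_gamma_in_hull_if_kernel:
  fixes A0 A1 :: "real^'n^'n"
  assumes sym: "transpose A0 = A0" "transpose A1 = A1"
    and ker: "(A0 + \<gamma> *\<^sub>R A1) *v u = 0"
    and curv: "u \<bullet> (A1 *v u) \<noteq> 0" "(u \<bullet> (A1 *v u)) * quad A1 b1 c1 x \<le> 0"
    and le: "q_comb (quad A0 b0 c0) (quad A1 b1 c1) \<gamma> x \<le> t"
  shows "(x, t) \<in> convex hull S_epi (quad A0 b0 c0) (quad A1 b1 c1)"
proof -
  define a where "a = u \<bullet> (A1 *v u)"
  define b where "b = 2 * (u \<bullet> (A1 *v x) + b1 \<bullet> u)"
  define c where "c = quad A1 b1 c1 x"
  have line: "quad A1 b1 c1 (x + s *\<^sub>R u) = a * s\<^sup>2 + b * s + c" for s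
    by (simp add: quad_add_scaleR[OF sym(2)] a_def b_def c_def)
  obtain s1 s2 where s: "s1 \<le> 0" "0 \<le> s2"
    and z: "quad A1 b1 c1 (x + s1 *\<^sub>R u) = 0" "quad A1 b1 c1 (x + s2 *\<^sub>R u) = 0"
  proof (cases "a > 0")
    case True
    then have "c \<le> 0" using curv by (simp add: a_def c_def mult_le_0_iff)
    then show ?thesis
      using quadratic_roots_around_zero[OF True, of c b] that by (auto simp: line)
  next
    case False
    then have a: "- a > 0" using curv by (simp add: a_def)
    then have "- c \<le> 0" using curv by (simp add: a_def c_def mult_le_0_iff)
    \<comment> \<open>Negating all coefficients turns the concave case into the convex one without
      moving the roots.\<close>
    from quadratic_roots_around_zero[OF a this, of "- b"] obtain s1 s2
      where "s1 \<le> 0" "0 \<le> s2" "- a * s1\<^sup>2 + - b * s1 + - c = 0" "- a * s2\<^sup>2 + - b * s2 + - c = 0"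
      by blast
    then show ?thesis by (intro that[of s1 s2]) (auto simp: line)
  qed
  \<comment> \<open>This is the slope of \<open>q_comb\<close> along \<open>u\<close>; the quadratic
    term and the cross term with \<open>x\<close> vanish because \<open>u\<close> is in the
    kernel.\<close>
  define r where "r = 2 * ((b0 + \<gamma> *\<^sub>R b1) \<bullet> u)"
  have ker': "u \<bullet> ((A0 + \<gamma> *\<^sub>R A1) *v x) = 0"
    using symmetric_matrix_inner_commute[OF transpose_pencil[OF sym], of u \<gamma> x] ker by simp
  have affine: "q_comb (quad A0 b0 c0) (quad A1 b1 c1) \<gamma> (x + s *\<^sub>R u)
      = q_comb (quad A0 b0 c0) (quad A1 b1 c1) \<gamma> x + r * s" for s
    unfolding q_comb_quad quad_add_scaleR[OF transpose_pencil[OF sym]] ker' ker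
    by (simp add: r_def)
  \<comment> \<open>Where \<open>q1\<close> vanishes, \<open>q0\<close> agrees with
    \<open>q_comb\<close>, and the lifted direction \<open>(u, r)\<close> preserves the slack
    \<open>t\<close> minus \<open>q_comb\<close>.\<close>
  have "(x, t) + s *\<^sub>R (u, r) \<in> S_epi (quad A0 b0 c0) (quad A1 b1 c1)"
    if "quad A1 b1 c1 (x + s *\<^sub>R u) = 0" for s
    using affine[of s] le that by (simp add: S_epi_def q_comb_def algebra_simps)
  with s z show ?thesis by (intro mem_convex_hull_between[of s1 s2 _ "(u, r)"]) auto
qed

text \<open>On the feasible set the added term is nonpositive, so \<open>q_comb\<close> lies below
  \<open>q0\<close> there; its epigraph is convex and hence contains the hull.\<close>

lemma convex_hull_S_epi_le:
  assumes "convex_on UNIV (q_comb q0 q1 \<gamma>)" "0 \<le> \<gamma>"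
  shows "convex hull S_epi q0 q1 \<subseteq> S_gamma q0 q1 \<gamma>"
proof (rule hull_minimal)
  have "q_comb q0 q1 \<gamma> x \<le> q0 x" if "q1 x \<le> 0" for x
    using that assms(2) by (simp add: q_comb_def mult_nonneg_nonpos)
  then show "S_epi q0 q1 \<subseteq> S_gamma q0 q1 \<gamma>"
    by (force simp: S_epi_def S_gamma_def)
  have "S_gamma q0 q1 \<gamma> = epigraph UNIV (q_comb q0 q1 \<gamma>)"
    by (auto simp: S_gamma_def epigraph_def)
  then show "convex (S_gamma q0 q1 \<gamma>)"
    using assms(1) by (simp add: convex_epigraph)
qed

section \<open>The interval of semidefinite pencil members\<close>

lemma Gamma_set_iff:
  fixes A0 A1 :: "real^'n^'n"
  assumes "transpose A0 = A0" "transpose A1 = A1"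
  shows "\<gamma> \<in> Gamma_set A0 A1
    \<longleftrightarrow> 0 \<le> \<gamma> \<and> (\<forall>x. 0 \<le> x \<bullet> (A0 *v x) + \<gamma> * (x \<bullet> (A1 *v x)))"
  by (simp add: Gamma_set_def pos_semidef_def inner_pencil transpose_pencil assms)

lemma closed_Gamma_set:
  fixes A0 A1 :: "real^'n^'n"
  assumes "transpose A0 = A0" "transpose A1 = A1"
  shows "closed (Gamma_set A0 A1)"
proof -
  have "Gamma_set A0 A1
      = {0..} \<inter> (\<Inter>x. {\<gamma>. 0 \<le> x \<bullet> (A0 *v x) + \<gamma> * (x \<bullet> (A1 *v x))})"
    by (auto simp: Gamma_set_iff[OF assms])
  also have "closed \<dots>"
    by (intro closed_Int closed_INT closed_Collect_le continuous_intros ballI closed_atLeast)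
  finally show ?thesis .
qed

lemma is_interval_Gamma_set:
  fixes A0 A1 :: "real^'n^'n"
  assumes "transpose A0 = A0" "transpose A1 = A1"
  shows "is_interval (Gamma_set A0 A1)"
  unfolding is_interval_1
proof (intro ballI allI impI)
  fix a b \<gamma>
  assume ab: "a \<in> Gamma_set A0 A1" "b \<in> Gamma_set A0 A1" and \<gamma>: "a \<le> \<gamma> \<and> \<gamma> \<le> b"
  have "0 \<le> x \<bullet> (A0 *v x) + \<gamma> * (x \<bullet> (A1 *v x))" for x
  \<comment> \<open>The inequality is monotone in \<open>\<gamma>\<close>; the sign of this slope
    decides whether it is inherited from \<open>a\<close> or from \<open>b\<close>.\<close>
  proof (cases "0 \<le> x \<bullet> (A1 *v x)")
    case True
    then have "a * (x \<bullet> (A1 *v x)) \<le> \<gamma> * (x \<bullet> (A1 *v x))" using \<gamma> by (intro mult_right_mono) auto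
    moreover have "0 \<le> x \<bullet> (A0 *v x) + a * (x \<bullet> (A1 *v x))"
      using ab by (simp add: Gamma_set_iff[OF assms])
    ultimately show ?thesis by linarith
  next
    case False
    then have "b * (x \<bullet> (A1 *v x)) \<le> \<gamma> * (x \<bullet> (A1 *v x))"
      using \<gamma> by (intro mult_right_mono_neg) auto
    moreover have "0 \<le> x \<bullet> (A0 *v x) + b * (x \<bullet> (A1 *v x))"
      using ab by (simp add: Gamma_set_iff[OF assms])
    ultimately show ?thesis by linarith
  qed
  then show "\<gamma> \<in> Gamma_set A0 A1" using ab \<gamma> by (auto simp: Gamma_set_iff[OF assms])
qed

text \<open>A semidefinite matrix with trivial kernel is definite, and definiteness leaves room for
  perturbation. Contrapositively, a positive left endpoint and any right endpoint have a kernel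
  vector.\<close>

lemma Gamma_set_interior_if_no_kernel:
  fixes A0 A1 :: "real^'n^'n"
  assumes "transpose A0 = A0" "transpose A1 = A1" "\<gamma> \<in> Gamma_set A0 A1"
    and noker: "\<And>u. (A0 + \<gamma> *\<^sub>R A1) *v u = 0 \<Longrightarrow> u = 0"
  obtains e where "e > 0" "\<And>\<gamma>'. 0 \<le> \<gamma>' \<Longrightarrow> \<bar>\<gamma>' - \<gamma>\<bar> \<le> e \<Longrightarrow> \<gamma>' \<in> Gamma_set A0 A1"
proof -
  have psd: "pos_semidef (A0 + \<gamma> *\<^sub>R A1)" using assms by (simp add: Gamma_set_def)
  then have "pos_def (A0 + \<gamma> *\<^sub>R A1)"
    using noker pos_semidef_kernel[OF psd]
    by (force simp: pos_def_def pos_semidef_def order_less_le)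
  then obtain e where e: "e > 0" "\<And>s. \<bar>s\<bar> \<le> e \<Longrightarrow> pos_semidef (A0 + \<gamma> *\<^sub>R A1 + s *\<^sub>R A1)"
    using pos_def_perturb[OF _ assms(2)] by blast
  show thesis
  proof
    show "e > 0" by fact
    fix \<gamma>' assume \<gamma>': "0 \<le> \<gamma>'" "\<bar>\<gamma>' - \<gamma>\<bar> \<le> e"
    have "A0 + \<gamma> *\<^sub>R A1 + (\<gamma>' - \<gamma>) *\<^sub>R A1 = A0 + \<gamma>' *\<^sub>R A1" by (simp add: algebra_simps)
    then have "pos_semidef (A0 + \<gamma>' *\<^sub>R A1)" using e(2)[OF \<gamma>'(2)] by argo
    with \<gamma>'(1) show "\<gamma>' \<in> Gamma_set A0 A1" by (simp add: Gamma_set_def)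
  qed
qed

text \<open>The value of the form at \<open>u\<close> is affine in the pencil parameter, zero at
  \<open>\<gamma>\<close> and positive at \<open>\<delta>\<close>, which fixes the sign of its
  slope.\<close>

lemma pencil_kernel_curvature:
  fixes A0 A1 :: "real^'n^'n"
  assumes "pos_def (A0 + \<delta> *\<^sub>R A1)" "(A0 + \<gamma> *\<^sub>R A1) *v u = 0" "u \<noteq> 0"
  shows "0 < (\<delta> - \<gamma>) * (u \<bullet> (A1 *v u))"
proof -
  have "0 < u \<bullet> ((A0 + \<delta> *\<^sub>R A1) *v u)" using assms by (simp add: pos_def_def)
  moreover have "u \<bullet> ((A0 + \<gamma> *\<^sub>R A1) *v u) = 0" using assms by simp
  ultimately show ?thesis unfolding inner_pencil by (simp add: algebra_simps)
qed

text \<open>A direction of negative curvature of \<open>A1\<close> would bound every member of the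
  interval by a fixed ratio.\<close>

lemma pos_semidef_if_Gamma_set_unbounded:
  fixes A0 A1 :: "real^'n^'n"
  assumes "transpose A0 = A0" "transpose A1 = A1" "\<not> bdd_above (Gamma_set A0 A1)"
  shows "pos_semidef A1"
proof -
  have "0 \<le> x \<bullet> (A1 *v x)" for x
  proof (rule ccontr)
    assume neg: "\<not> 0 \<le> x \<bullet> (A1 *v x)"
    have "\<gamma> \<le> (x \<bullet> (A0 *v x)) / - (x \<bullet> (A1 *v x))" if "\<gamma> \<in> Gamma_set A0 A1" for \<gamma>
    proof -
      have "0 \<le> x \<bullet> (A0 *v x) + \<gamma> * (x \<bullet> (A1 *v x))"
        using that by (simp add: Gamma_set_iff[OF assms(1,2)])
      then show ?thesis using neg by (subst pos_le_divide_eq) auto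
    qed
    then show False using assms(3) by (auto simp: bdd_above_def)
  qed
  then show ?thesis using assms by (simp add: pos_semidef_def)
qed

section \<open>Attainment and transfer of minima\<close>

text \<open>\<open>q0\<close> alone may fail to be coercive, but on the feasible set it dominates
  the coercive \<open>q_comb\<close>. Hence the feasible points with value at most
  \<open>q0 x0\<close> form a compact set.\<close>

lemma quad_min_exists:
  fixes A0 A1 :: "real^'n^'n"
  assumes "pos_def (A0 + \<gamma> *\<^sub>R A1)" "0 \<le> \<gamma>" "quad A1 b1 c1 x0 \<le> 0"
  obtains x where "quad A1 b1 c1 x \<le> 0"
    "\<And>y. quad A1 b1 c1 y \<le> 0 \<Longrightarrow> quad A0 b0 c0 x \<le> quad A0 b0 c0 y"
proof -
  let ?q0 = "quad A0 b0 c0" and ?q1 = "quad A1 b1 c1"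
  let ?X = "{x. ?q1 x \<le> 0} \<inter> {x. ?q0 x \<le> ?q0 x0}"
  have "q_comb ?q0 ?q1 \<gamma> x \<le> ?q0 x0" if "x \<in> ?X" for x
    using that mult_nonneg_nonpos[OF assms(2), of "?q1 x"] by (simp add: q_comb_def)
  then have "?X \<subseteq> {x. q_comb ?q0 ?q1 \<gamma> x \<le> ?q0 x0}" by blast
  then have "bounded ?X"
    unfolding q_comb_quad by (rule bounded_subset[OF bounded_quad_sublevel[OF assms(1)]])
  moreover have "closed ?X"
    by (intro closed_Int closed_Collect_le continuous_on_quad continuous_on_const)
  ultimately have "compact ?X" by (simp add: compact_eq_bounded_closed)
  then obtain x where x: "x \<in> ?X" "\<And>y. y \<in> ?X \<Longrightarrow> ?q0 x \<le> ?q0 y"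
    using continuous_attains_inf[of ?X ?q0] assms(3) continuous_on_quad by blast
  show thesis
  proof
    show "?q1 x \<le> 0" using x by simp
    fix y assume "?q1 y \<le> 0"
    then show "?q0 x \<le> ?q0 y" using x(1) x(2)[of y] by (cases "?q0 y \<le> ?q0 x0") auto
  qed
qed

text \<open>Taking the convex hull does not lower the infimum of \<open>t\<close>, since the
  half-space \<open>m \<le> t\<close> is convex.\<close>

lemma convex_hull_S_epi_min_le:
  fixes x :: "'a::real_vector"
  assumes "\<And>y. q1 y \<le> 0 \<Longrightarrow> m \<le> q0 y" "(x, t) \<in> convex hull S_epi q0 q1"
  shows "m \<le> t"
proof -
  have "{(x :: 'a, t). m \<le> t} = UNIV \<times> {m..}" by auto
  then have "convex {(x :: 'a, t). m \<le> t}" by (simp add: convex_Times)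
  moreover have "S_epi q0 q1 \<subseteq> {(x, t). m \<le> t}"
    using assms(1) by (force simp: S_epi_def)
  ultimately have "convex hull S_epi q0 q1 \<subseteq> {(x, t). m \<le> t}" by (simp add: hull_minimal)
  with assms(2) show ?thesis by blast
qed

section \<open>Hull and minimum identities in the bounded and unbounded cases\<close>

theorem theorem3:
  fixes A0 A1 :: "real^'n^'n" and b0 b1 :: "real^'n" and c0 c1 :: real
    and q0 q1 :: "real^'n \<Rightarrow> real"
  assumes "transpose A0 = A0" and "transpose A1 = A1"
    and "q0 = quad A0 b0 c0" and "q1 = quad A1 b1 c1"
    and "\<exists>\<gamma>\<ge>0. pos_def (A0 + \<gamma> *\<^sub>R A1)"
  shows "Gamma_set A0 A1 \<noteq> {} \<and> closed (Gamma_set A0 A1) \<and> is_interval (Gamma_set A0 A1) \<and>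
    (bdd_above (Gamma_set A0 A1) \<longrightarrow>
       convex hull (S_epi q0 q1) =
         S_gamma q0 q1 (gamma_minus A0 A1) \<inter> S_gamma q0 q1 (gamma_plus A0 A1) \<and>
       (\<exists>m. is_min q0 {x. q1 x \<le> 0} m \<and>
            is_min (\<lambda>x. max (q_comb q0 q1 (gamma_minus A0 A1) x)
                            (q_comb q0 q1 (gamma_plus A0 A1) x)) UNIV m)) \<and>
    (\<not> bdd_above (Gamma_set A0 A1) \<longrightarrow>
       convex_on UNIV q1 \<and>
       convex hull (S_epi q0 q1) =
         S_gamma q0 q1 (gamma_minus A0 A1) \<inter> {(x, t). q1 x \<le> 0} \<and>
       (\<exists>m. is_min q0 {x. q1 x \<le> 0} m \<and>
            is_min (q_comb q0 q1 (gamma_minus A0 A1)) {x. q1 x \<le> 0} m))"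
proof -
  note sym = assms(1,2) and q = assms(3,4)
  let ?G = "Gamma_set A0 A1" and ?l = "gamma_minus A0 A1" and ?r = "gamma_plus A0 A1"
  obtain \<delta> where \<delta>: "0 \<le> \<delta>" "pos_def (A0 + \<delta> *\<^sub>R A1)" using assms(5) by blast
  have \<delta>G: "\<delta> \<in> ?G"
    using \<delta> pos_def_imp_pos_semidef by (simp add: Gamma_set_def)
  have closed: "closed ?G" by (rule closed_Gamma_set[OF sym])
  have bdd_below: "bdd_below ?G" by (auto simp: bdd_below_def Gamma_set_def)
  have lG: "?l \<in> ?G"
    unfolding gamma_minus_def using closed_contains_Inf[OF _ bdd_below closed] \<delta>G by blast
  have l_le: "?l \<le> \<gamma>" if "\<gamma> \<in> ?G" for \<gamma>
    unfolding gamma_minus_def using cInf_lower[OF that bdd_below] .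
  have hull_sub: "convex hull S_epi q0 q1 \<subseteq> S_gamma q0 q1 \<gamma>" if "\<gamma> \<in> ?G" for \<gamma>
    using that convex_on_quad unfolding q Gamma_set_def
    by (intro convex_hull_S_epi_le) (auto simp: q_comb_quad)
  have comb_le: "q_comb q0 q1 \<gamma> x \<le> q0 x" if "\<gamma> \<in> ?G" "q1 x \<le> 0" for \<gamma> x
    using that by (simp add: q_comb_def Gamma_set_def mult_nonneg_nonpos)
  \<comment> \<open>Both cases use this inclusion. If the left endpoint is 0, then
    \<open>q_comb\<close> is \<open>q0\<close> and the point already lies in \<open>S_epi\<close>;
    otherwise a kernel vector is available.\<close>
  have left: "(x, t) \<in> convex hull S_epi q0 q1"
    if x: "q1 x \<le> 0" and t: "q_comb q0 q1 ?l x \<le> t" for x t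
  proof (cases "?l = 0")
    case True
    then have "(x, t) \<in> S_epi q0 q1" using x t by (simp add: S_epi_def q_comb_def)
    then show ?thesis by (rule hull_inc)
  next
    case False
    with lG have l: "0 < ?l" by (simp add: Gamma_set_def)
    have "\<exists>u. u \<noteq> 0 \<and> (A0 + ?l *\<^sub>R A1) *v u = 0"
    proof (rule ccontr)
      assume "\<nexists>u. u \<noteq> 0 \<and> (A0 + ?l *\<^sub>R A1) *v u = 0"
      then obtain e where e: "e > 0" "\<And>\<gamma>'. 0 \<le> \<gamma>' \<Longrightarrow> \<bar>\<gamma>' - ?l\<bar> \<le> e \<Longrightarrow> \<gamma>' \<in> ?G"
        using Gamma_set_interior_if_no_kernel[OF sym lG] by blast
      \<comment> \<open>Capping the step by \<open>?l\<close> keeps the new parameter nonnegative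
        while still moving strictly to the left.\<close>
      have "?l - min e ?l \<in> ?G" using e(1) l by (intro e(2)) auto
      from l_le[OF this] show False using e(1) l by (simp add: min_def split: if_splits)
    qed
    then obtain u where u: "u \<noteq> 0" "(A0 + ?l *\<^sub>R A1) *v u = 0" by blast
    have "0 < u \<bullet> (A1 *v u)"
      using pencil_kernel_curvature[OF \<delta>(2) u(2,1)] l_le[OF \<delta>G] by (simp add: zero_less_mult_iff)
    then show ?thesis
      using S_gamma_in_hull_if_kernel[OF sym u(2)] x t unfolding q
      by (simp add: mult_nonneg_nonpos)
  qed
  have bounded_case: "convex hull S_epi q0 q1 = S_gamma q0 q1 ?l \<inter> S_gamma q0 q1 ?r \<and>
      (\<exists>m. is_min q0 {x. q1 x \<le> 0} m \<and>
        is_min (\<lambda>x. max (q_comb q0 q1 ?l x) (q_comb q0 q1 ?r x)) UNIV m)"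
    if bdd: "bdd_above ?G"
  proof -
    have rG: "?r \<in> ?G"
      unfolding gamma_plus_def using closed_contains_Sup[OF _ bdd closed] \<delta>G by blast
    have r_ge: "\<gamma> \<le> ?r" if "\<gamma> \<in> ?G" for \<gamma>
      unfolding gamma_plus_def using cSup_upper[OF that bdd] .
    have "\<exists>u. u \<noteq> 0 \<and> (A0 + ?r *\<^sub>R A1) *v u = 0"
    proof (rule ccontr)
      assume "\<nexists>u. u \<noteq> 0 \<and> (A0 + ?r *\<^sub>R A1) *v u = 0"
      then obtain e where e: "e > 0" "\<And>\<gamma>'. 0 \<le> \<gamma>' \<Longrightarrow> \<bar>\<gamma>' - ?r\<bar> \<le> e \<Longrightarrow> \<gamma>' \<in> ?G"
        using Gamma_set_interior_if_no_kernel[OF sym rG] by blast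
      have "?r + e \<in> ?G" using e(1) rG by (intro e(2)) (auto simp: Gamma_set_def)
      from r_ge[OF this] show False using e(1) by simp
    qed
    then obtain u where u: "u \<noteq> 0" "(A0 + ?r *\<^sub>R A1) *v u = 0" by blast
    have neg: "u \<bullet> (A1 *v u) < 0"
      using pencil_kernel_curvature[OF \<delta>(2) u(2,1)] r_ge[OF \<delta>G] by (simp add: zero_less_mult_iff)
    have right: "(x, t) \<in> convex hull S_epi q0 q1"
      if "0 \<le> q1 x" "q_comb q0 q1 ?r x \<le> t" for x t
      using S_gamma_in_hull_if_kernel[OF sym u(2)] neg that unfolding q
      by (simp add: mult_nonpos_nonneg)
    \<comment> \<open>The sign of \<open>q1 x\<close> selects the endpoint whose kernel direction is
      used.\<close>
    have mem: "(x, t) \<in> convex hull S_epi q0 q1"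
      if "q_comb q0 q1 ?l x \<le> t" "q_comb q0 q1 ?r x \<le> t" for x t
      using that left[of x t] right[of x t] by linarith
    have hull: "convex hull S_epi q0 q1 = S_gamma q0 q1 ?l \<inter> S_gamma q0 q1 ?r"
      using hull_sub[OF lG] hull_sub[OF rG] mem by (auto simp: S_gamma_def)
    \<comment> \<open>Feasibility comes for free: with \<open>t\<close> large enough, the origin
      lifts to a point of the hull, so \<open>S_epi\<close> cannot be empty.\<close>
    have "convex hull S_epi q0 q1 \<noteq> {}"
      using mem[of 0 "max (q_comb q0 q1 ?l 0) (q_comb q0 q1 ?r 0)"] by auto
    then obtain x0 where "q1 x0 \<le> 0" by (auto simp: S_epi_def)
    then obtain x where x: "q1 x \<le> 0" "\<And>y. q1 y \<le> 0 \<Longrightarrow> q0 x \<le> q0 y"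
      using quad_min_exists[OF \<delta>(2,1)] unfolding q by blast
    \<comment> \<open>Each \<open>y\<close>, paired with its own objective value, lies in the hull,
      so that value is at least the constrained minimum.\<close>
    have lower: "q0 x \<le> max (q_comb q0 q1 ?l y) (q_comb q0 q1 ?r y)" for y
      by (rule convex_hull_S_epi_min_le[OF x(2) mem[of y]]) auto
    have "max (q_comb q0 q1 ?l x) (q_comb q0 q1 ?r x) = q0 x"
      using lower[of x] comb_le[OF lG x(1)] comb_le[OF rG x(1)] by (intro antisym) auto
    then have "is_min (\<lambda>x. max (q_comb q0 q1 ?l x) (q_comb q0 q1 ?r x)) UNIV (ereal (q0 x))"
      using lower unfolding is_min_def by (intro disjI2 bexI[of _ x]) auto
    moreover have "is_min q0 {x. q1 x \<le> 0} (ereal (q0 x))"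
      using x by (auto simp: is_min_def)
    ultimately show ?thesis using hull by blast
  qed
  have unbounded_case: "convex_on UNIV q1 \<and>
      convex hull S_epi q0 q1 = S_gamma q0 q1 ?l \<inter> {(x, t). q1 x \<le> 0} \<and>
      (\<exists>m. is_min q0 {x. q1 x \<le> 0} m \<and> is_min (q_comb q0 q1 ?l) {x. q1 x \<le> 0} m)"
    if "\<not> bdd_above ?G"
  proof -
    have convex: "convex_on UNIV q1"
      unfolding q by (rule convex_on_quad[OF pos_semidef_if_Gamma_set_unbounded[OF sym that]])
    have "{(x, t :: real). q1 x \<le> 0} = {x \<in> UNIV. q1 x \<le> 0} \<times> UNIV" by auto
    also have "convex \<dots>"
      using convex_lower_level_set[OF convex] by (intro convex_Times) auto
    finally have "convex hull S_epi q0 q1 \<subseteq> {(x, t). q1 x \<le> 0}"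
      by (intro hull_minimal) (auto simp: S_epi_def)
    then have hull: "convex hull S_epi q0 q1 = S_gamma q0 q1 ?l \<inter> {(x, t). q1 x \<le> 0}"
      using hull_sub[OF lG] left by (auto simp: S_gamma_def)
    have "\<exists>m. is_min q0 {x. q1 x \<le> 0} m \<and> is_min (q_comb q0 q1 ?l) {x. q1 x \<le> 0} m"
    proof (cases "\<exists>x. q1 x \<le> 0")
      case False
      \<comment> \<open>A convex \<open>q1\<close> may be positive everywhere; both problems are
        then infeasible and share the value \<open>\<infinity>\<close>.\<close>
      then show ?thesis by (intro exI[of _ \<infinity>]) (auto simp: is_min_def)
    next
      case True
      then obtain x where x: "q1 x \<le> 0" "\<And>y. q1 y \<le> 0 \<Longrightarrow> q0 x \<le> q0 y"
        using quad_min_exists[OF \<delta>(2,1)] unfolding q by blast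
      have lower: "q0 x \<le> q_comb q0 q1 ?l y" if "q1 y \<le> 0" for y
        by (rule convex_hull_S_epi_min_le[OF x(2) left[OF that order_refl]])
      have "q_comb q0 q1 ?l x = q0 x"
        using lower[OF x(1)] comb_le[OF lG x(1)] by (rule antisym[rotated])
      then have "is_min (q_comb q0 q1 ?l) {x. q1 x \<le> 0} (ereal (q0 x))"
        using lower x(1) unfolding is_min_def by (intro disjI2 bexI[of _ x]) auto
      moreover have "is_min q0 {x. q1 x \<le> 0} (ereal (q0 x))"
        using x by (auto simp: is_min_def)
      ultimately show ?thesis by blast
    qed
    with convex hull show ?thesis by blast
  qed
  have "?G \<noteq> {}" using \<delta>G by blast
  then show ?thesis
    by (intro conjI[of "?G \<noteq> {}"] conjI[of "closed ?G"] conjI[of "is_interval ?G"]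
        conjI[of "bdd_above ?G \<longrightarrow> _"] impI closed is_interval_Gamma_set[OF sym]
        bounded_case unbounded_case)
qed

end
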